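(* Let $n\geqslant 2$ be an integer and set $R=\mathbb{Z}/n\mathbb{Z}$. Let $S\supset R$ be a commutative $R$-algebra that is free of rank $d\geqslant 1$ over $R$. Let $\sigma$ be an $R$-automorphism of $S$ and let $\mathcal{G}$ be the group generated by $\sigma$. Assume that $S$ is a free $R[\mathcal{G}]$-module of rank $1$: there exists an element $\omega$ in $S$ such that $(\omega,\sigma(\omega),\ldots,\sigma^{d-1}(\omega))$ is an $R$-basis of $S$. Let $\theta$ be a unit in $S$ such that $\theta^n=\sigma(\theta)$. Let $p$ be a prime divisor of $n$. Assume that $S/pS$ is reduced and that $\theta\bmod p$ generates a subgroup of order at least $n^{\lfloor\sqrt d\rfloor}$ in $(S/pS)^*$. Then $n$ is a power of $p$.
   Context: $R[\mathcal{G}]$ is the group ring of the cyclic group $\mathcal{G}=\langle\sigma\rangle$ (which has order $d$) acting on $S$. *)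

theory Defs
  imports
    Complex_Main
    "HOL-Number_Theory.Residues"
    "HOL-Algebra.Module"
    "HOL-Algebra.QuotRing"
    "HOL-Algebra.Bij"
    "HOL-Algebra.Generated_Groups"
begin

definition is_basis ::
    "('r, 'k) ring_scheme \<Rightarrow> ('r, 'a, 'm) module_scheme \<Rightarrow> nat \<Rightarrow> (nat \<Rightarrow> 'a) \<Rightarrow> bool"
  where "is_basis R M d b \<longleftrightarrow>
    (\<forall>i<d. b i \<in> carrier M) \<and>
    (\<forall>x\<in>carrier M. \<exists>!c. c \<in> {..<d} \<rightarrow>\<^sub>E carrier R \<and>
        x = (\<Oplus>\<^bsub>M\<^esub>i\<in>{..<d}. c i \<odot>\<^bsub>M\<^esub> b i))"

definition free_of_rank ::
    "('r, 'k) ring_scheme \<Rightarrow> ('r, 'a, 'm) module_scheme \<Rightarrow> nat \<Rightarrow> bool"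
  where "free_of_rank R M d \<longleftrightarrow> (\<exists>b. is_basis R M d b)"

text \<open>As in \<^const>\<open>AutoGroup\<close>, automorphisms are represented by functions that are extensional on
  the carrier, so that each one has a unique representative and cardinalities are meaningful.\<close>

definition alg_auto ::
    "('r, 'k) ring_scheme \<Rightarrow> ('r, 'a, 'm) module_scheme \<Rightarrow> ('a \<Rightarrow> 'a) set"
  where "alg_auto R S = {f \<in> ring_hom S S \<inter> Bij (carrier S).
    \<forall>r\<in>carrier R. \<forall>x\<in>carrier S. f (r \<odot>\<^bsub>S\<^esub> x) = r \<odot>\<^bsub>S\<^esub> f x}"

definition AlgAut ::
    "('r, 'k) ring_scheme \<Rightarrow> ('r, 'a, 'm) module_scheme \<Rightarrow> ('a \<Rightarrow> 'a) monoid"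
  where "AlgAut R S = BijGroup (carrier S) \<lparr>carrier := alg_auto R S\<rparr>"

lemma group_AlgAut:
  assumes "algebra R S"
  shows "group (AlgAut R S)"
proof -
  interpret A: algebra R S by fact
  interpret B: group "BijGroup (carrier S)" by (rule group_BijGroup)
  have "subgroup (alg_auto R S) (BijGroup (carrier S))"
  proof (rule B.subgroupI)
    show "alg_auto R S \<subseteq> carrier (BijGroup (carrier S))"
      by (auto simp: alg_auto_def BijGroup_def)
    have "(\<lambda>x\<in>carrier S. x) \<in> alg_auto R S"
      by (auto simp: alg_auto_def id_Bij ring_hom_def)
    then show "alg_auto R S \<noteq> {}" by blast
  next
    fix f assume f: "f \<in> alg_auto R S"
    then have fB: "f \<in> Bij (carrier S)" and fh: "f \<in> ring_hom S S"
      and fl: "\<And>r x. r \<in> carrier R \<Longrightarrow> x \<in> carrier S \<Longrightarrow> f (r \<odot>\<^bsub>S\<^esub> x) = r \<odot>\<^bsub>S\<^esub> f x"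
      by (auto simp: alg_auto_def)
    have bij: "bij_betw f (carrier S) (carrier S)" using fB by (simp add: Bij_def)
    let ?g = "inv_into (carrier S) f"
    have gc: "?g x \<in> carrier S" if "x \<in> carrier S" for x
      using Bij_inv_into_mem[OF fB that] .
    have gf: "?g (f x) = x" if "x \<in> carrier S" for x
      using bij that by (simp add: bij_betw_inv_into_left)
    have fg: "f (?g x) = x" if "x \<in> carrier S" for x
      using bij that by (simp add: bij_betw_inv_into_right)
    have 1: "?g (x \<otimes>\<^bsub>S\<^esub> y) = ?g x \<otimes>\<^bsub>S\<^esub> ?g y" if "x \<in> carrier S" "y \<in> carrier S" for x y
      using that gf[of "?g x \<otimes>\<^bsub>S\<^esub> ?g y"] by (simp add: gc fg ring_hom_mult[OF fh])
    have 2: "?g (x \<oplus>\<^bsub>S\<^esub> y) = ?g x \<oplus>\<^bsub>S\<^esub> ?g y" if "x \<in> carrier S" "y \<in> carrier S" for x y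
      using that gf[of "?g x \<oplus>\<^bsub>S\<^esub> ?g y"] by (simp add: gc fg ring_hom_add[OF fh])
    have 3: "?g \<one>\<^bsub>S\<^esub> = \<one>\<^bsub>S\<^esub>"
      using gf[of "\<one>\<^bsub>S\<^esub>"] by (simp add: ring_hom_one[OF fh])
    have 4: "?g (r \<odot>\<^bsub>S\<^esub> x) = r \<odot>\<^bsub>S\<^esub> ?g x" if "r \<in> carrier R" "x \<in> carrier S" for r x
      using that gf[of "r \<odot>\<^bsub>S\<^esub> ?g x"] by (simp add: gc fg fl)
    have "(\<lambda>x\<in>carrier S. ?g x) \<in> alg_auto R S"
      using restrict_inv_into_Bij[OF fB] by (auto simp: alg_auto_def ring_hom_def gc 1 2 3 4)
    then show "inv\<^bsub>BijGroup (carrier S)\<^esub> f \<in> alg_auto R S"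
      using inv_BijGroup[OF fB] by simp
  next
    fix f g assume *: "f \<in> alg_auto R S" "g \<in> alg_auto R S"
    then have fg: "f \<in> Bij (carrier S)" "g \<in> Bij (carrier S)"
      by (auto simp: alg_auto_def)
    have "compose (carrier S) f g \<in> ring_hom S S"
      using * by (auto simp: alg_auto_def ring_hom_def compose_def Pi_iff)
    moreover have "\<forall>r\<in>carrier R. \<forall>x\<in>carrier S.
        compose (carrier S) f g (r \<odot>\<^bsub>S\<^esub> x) = r \<odot>\<^bsub>S\<^esub> compose (carrier S) f g x"
      using * by (auto simp: alg_auto_def ring_hom_def compose_def Pi_iff)
    ultimately show "f \<otimes>\<^bsub>BijGroup (carrier S)\<^esub> g \<in> alg_auto R S"
      using fg compose_Bij[OF fg] by (simp add: alg_auto_def BijGroup_def)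
  qed
  then show ?thesis
    unfolding AlgAut_def by (rule B.subgroup_imp_group)
qed

definition reduced_ring :: "('a, 'm) ring_scheme \<Rightarrow> bool"
  where "reduced_ring Q \<longleftrightarrow>
    (\<forall>x\<in>carrier Q. \<forall>k::nat. x [^]\<^bsub>Q\<^esub> k = \<zero>\<^bsub>Q\<^esub> \<longrightarrow> x = \<zero>\<^bsub>Q\<^esub>)"

definition multiples_ideal :: "('a, 'm) ring_scheme \<Rightarrow> nat \<Rightarrow> 'a set"
  where "multiples_ideal S p = PIdl\<^bsub>S\<^esub> ([p] \<cdot>\<^bsub>S\<^esub> \<one>\<^bsub>S\<^esub>)"

end

theory Submission
  imports Defs
begin

text \<open>
  Raising \<open>\<theta>\<close> to the power \<open>n\<close> is applying \<open>\<sigma>\<close>, and raising it to the power \<open>p\<close> turns out to be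
  applying some \<open>\<sigma>\<^sup>z\<close> modulo a maximal ideal above \<open>p\<close>. As \<open>\<sigma>\<^sup>d = 1\<close>, the many products of powers of
  \<open>p\<close> and \<open>n / p\<close> lead to at most \<open>d\<close> powers of \<open>\<theta>\<close>, while \<open>\<theta>\<close> has large order.
  Let \<open>r\<close> be the order of \<open>\<theta>\<close> in \<open>(S / pS)\<^sup>*\<close>.

  The normal basis forces the fixed ring of \<open>\<sigma>\<close> to be \<open>R\<close>, that is, the image of the integers
  (\<open>fixed_point_of_normal_basis_is_scalar\<close>). Hence, for every \<open>x\<close>, the polynomial
  \<open>F(X) = (X - x)(X - \<sigma> x) \<dots> (X - \<sigma>\<^bsup>d-1\<^esup> x)\<close> has coefficients in the prime ring. Two consequences
  follow, for a maximal ideal \<open>I\<close> of \<open>S\<close> containing \<open>p\<close>: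

  \<^item> Over the domain \<open>S / I\<close> of characteristic \<open>p\<close>, \<open>F(x\<^sup>p) = F(x)\<^sup>p = 0\<close>, so \<open>x\<^sup>p\<close> agrees modulo \<open>I\<close> with
    one of the conjugates \<open>\<sigma>\<^sup>i x\<close> (\<open>frobenius_is_conjugate\<close>).

  \<^item> If all conjugates of \<open>x\<close> lie in \<open>I\<close>, then the coefficients of \<open>F\<close> below the leading one are
    integers lying in \<open>I\<close>, hence divisible by \<open>p\<close>, so \<open>x\<^sup>d \<in> pS\<close> and \<open>x \<in> pS\<close> because \<open>S / pS\<close> is
    reduced (\<open>vanishes_if_conjugates_vanish\<close>).

  Since \<open>\<theta>\<^sup>n = \<sigma> \<theta>\<close>, the conjugates of \<open>\<theta>\<close> are the powers \<open>\<theta>\<close> to the \<open>n\<^sup>i\<close>. Applied to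
  \<open>\<theta>\<^sup>m - 1\<close>, whose conjugates are multiples of it, the second point shows that \<open>\<theta>\<close> has the same order
  \<open>r\<close> modulo \<open>I\<close> as modulo \<open>p\<close>. The first point then says \<open>p \<equiv> n\<^sup>z\<close> modulo \<open>r\<close> for some \<open>z\<close>, and
  \<open>\<sigma>\<^sup>d = 1\<close> says \<open>n\<^sup>d \<equiv> 1\<close> modulo \<open>r\<close> (\<open>exponents_cong_order\<close>).

  What remains is arithmetic (\<open>power_of_prime_if_exponents_cong\<close>). Let \<open>s = \<lfloor>\<surd>d\<rfloor>\<close> and \<open>q = n / p\<close>. Modulo
  \<open>r\<close> the \<open>(s + 1)\<^sup>2 > d\<close> numbers \<open>q\<^sup>i p\<^sup>j\<close> with \<open>i, j \<le> s\<close> are powers of \<open>n\<close>, of which there are at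
  most \<open>d\<close>, so two of them are congruent. All lie between \<open>1\<close> and \<open>n\<^sup>s \<le> r\<close>, so these two are equal; comparing prime
  factorizations, \<open>q\<close> and hence \<open>n\<close> is a power of \<open>p\<close>.
\<close>

section \<open>The arithmetic of the exponents\<close>

text \<open>
  Pigeonhole on \<open>q\<^sup>i p\<^sup>j\<close>, with \<open>q = n / p\<close>: the exponents are bounded by \<open>s\<close>, so each product is at
  most \<open>n\<^sup>s\<close>, and congruence modulo \<open>r\<close> implies equality. Using \<open>n\<^sup>i p\<^sup>j\<close> instead would give products
  as large as \<open>n\<^sup>s p\<^sup>s\<close>, for which this fails.
\<close>

lemma power_of_prime_if_exponents_cong:
  fixes n p d r s z :: nat
  assumes p: "prime p" "p dvd n" and n: "n \<ge> 2" and d: "d \<ge> 1" "d < (s + 1)\<^sup>2"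
    and r: "n ^ s \<le> r" "[n ^ d = 1] (mod r)" "[p = n ^ z] (mod r)"
  shows "\<exists>k. n = p ^ k"
proof -
  obtain q where q: "n = p * q" using p(2) by blast
  have q1: "q \<ge> 1" and p1: "p \<ge> 1" using q n p prime_ge_1_nat by (cases q; simp)+
  have n_pow: "[n ^ a = n ^ (a mod d)] (mod r)" for a
  proof -
    have "[(n ^ d) ^ (a div d) * n ^ (a mod d) = 1 ^ (a div d) * n ^ (a mod d)] (mod r)"
      using r(2) by (intro cong_mult cong_pow) auto
    moreover have "(n ^ d) ^ (a div d) * n ^ (a mod d) = n ^ a"
      unfolding power_mult[symmetric] power_add[symmetric] by simp
    ultimately show ?thesis by simp
  qed
  have "coprime (n ^ d) r" using r(2) cong_imp_coprime[OF cong_sym] by fastforce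
  then have "coprime n r" using d by simp
  then have cop: "coprime (p ^ s) r" using coprime_divisors[OF p(2) dvd_refl] by simp
  \<comment> \<open>As \<open>q \<equiv> n\<^bsup>1-z\<^esup>\<close>, the exponent of \<open>q\<^sup>i p\<^sup>j\<close> in terms of \<open>n\<close> would be \<open>i(1 - z) + zj\<close>, which can be
    negative. Multiplying by \<open>p\<^sup>s\<close> makes it the natural number \<open>e (i, j)\<close>; \<open>p\<^sup>s\<close> is cancelled later.\<close>
  define e where "e = (\<lambda>(i, j). i + z * (j + s - i))"
  have "\<not> inj_on (\<lambda>x. e x mod d) ({..s} \<times> {..s})"
  proof
    assume "inj_on (\<lambda>x. e x mod d) ({..s} \<times> {..s})"
    then have "card ({..s} \<times> {..s}) \<le> card {..<d}"
      using d(1) by (intro card_inj_on_le) auto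
    then show False using d by (simp add: power2_eq_square)
  qed
  then obtain i j i' j' where ij: "i \<le> s" "j \<le> s" "i' \<le> s" "j' \<le> s" "(i, j) \<noteq> (i', j')"
    and e: "e (i, j) mod d = e (i', j') mod d"
    by (auto simp: inj_on_def)
  have val: "[q ^ i * p ^ j * p ^ s = n ^ (e (i, j) mod d)] (mod r)" if "i \<le> s" for i j
  proof -
    have "p ^ j * p ^ s = p ^ i * p ^ (j + s - i)" using that by (simp flip: power_add)
    then have "q ^ i * p ^ j * p ^ s = n ^ i * p ^ (j + s - i)"
      by (simp add: q power_mult_distrib mult_ac)
    also have "[\<dots> = n ^ i * (n ^ z) ^ (j + s - i)] (mod r)"
      using r(3) by (intro cong_mult cong_pow) auto
    also have "n ^ i * (n ^ z) ^ (j + s - i) = n ^ e (i, j)"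
      by (simp add: e_def power_add power_mult)
    finally show ?thesis using n_pow cong_trans by blast
  qed
  have "[q ^ i * p ^ j * p ^ s = q ^ i' * p ^ j' * p ^ s] (mod r)"
    using val[OF ij(1), of j] val[OF ij(3), of j'] e by (metis cong_sym cong_trans)
  then have c: "[q ^ i * p ^ j = q ^ i' * p ^ j'] (mod r)"
    using cop by (simp add: cong_mult_rcancel_nat)
  have bounds: "1 \<le> q ^ i * p ^ j \<and> q ^ i * p ^ j \<le> r" if "i \<le> s" "j \<le> s" for i j
  proof -
    have "q ^ i * p ^ j \<le> q ^ s * p ^ s"
      using that p1 q1 by (intro mult_le_mono power_increasing) auto
    then show ?thesis using r(1) p1 q1 by (simp add: q power_mult_distrib mult.commute)
  qed
  \<comment> \<open>Subtracting one moves both numbers into the set of residues from \<open>0\<close> to \<open>r - 1\<close>; the value \<open>r\<close> itself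
    may occur.\<close>
  have eq: "q ^ i * p ^ j = q ^ i' * p ^ j'"
  proof -
    have "[int (q ^ i * p ^ j) - 1 = int (q ^ i' * p ^ j') - 1] (mod int r)"
      using c by (intro cong_diff) (simp_all add: cong_int_iff del: of_nat_mult of_nat_power)
    then have "int (q ^ i * p ^ j) - 1 = int (q ^ i' * p ^ j') - 1"
      using bounds[OF ij(1,2)] bounds[OF ij(3,4)] by (intro cong_less_imp_eq_int[of _ "int r"]) linarith+
    then show ?thesis by linarith
  qed
  have ii: "i \<noteq> i'"
  proof
    assume "i = i'"
    then have "p ^ j = p ^ j'" using eq q1 by simp
    then show False using ij(5) \<open>i = i'\<close> p(1) prime_gt_1_nat by (simp add: power_inject_exp)
  qed
  \<comment> \<open>A prime \<open>l \<noteq> p\<close> occurs in \<open>q\<^sup>i p\<^sup>j\<close> exactly \<open>i\<close> times as often as in \<open>q\<close>, and \<open>i \<noteq> i'\<close>.\<close>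
  have only_p: "l = p" if "prime l" "l dvd q" for l
  proof (rule ccontr)
    assume "l \<noteq> p"
    then have "multiplicity l p = 0"
      using that p by (simp add: multiplicity_distinct_prime_power[of l p 1, simplified])
    moreover have "multiplicity l (q ^ i * p ^ j) = multiplicity l (q ^ i' * p ^ j')"
      using eq by simp
    ultimately have "i * multiplicity l q = i' * multiplicity l q"
      using that p1 q1
      by (simp add: prime_elem_multiplicity_mult_distrib prime_elem_multiplicity_power_distrib)
    then show False using ii that q1 prime_multiplicity_gt_zero_iff[of l q] by simp
  qed
  obtain m where m: "q = p ^ multiplicity p q * m" "\<not> p dvd m"
    using multiplicity_decompose'[of q p] q1 p(1) by (metis not_one_le_zero prime_elem_not_unit
      prime_imp_prime_elem mult.commute)
  have "m = 1"
  proof (rule ccontr)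
    assume "m \<noteq> 1"
    then obtain l where "prime l" "l dvd m" using prime_factor_nat by blast
    then show False using only_p m by (metis dvd_mult)
  qed
  then have "n = p ^ Suc (multiplicity p q)" using q m by simp
  then show ?thesis by blast
qed

section \<open>Elementary symmetric functions\<close>

text \<open>
  The elementary symmetric functions of a finite family serve as the coefficients of
  \<open>\<Prod>(X + b\<^sub>i)\<close>. Writing them as explicit sums makes their symmetry a reindexing of the
  subsets.
\<close>

definition elem_sym :: "('a, 'm) ring_scheme \<Rightarrow> nat \<Rightarrow> 'i set \<Rightarrow> ('i \<Rightarrow> 'a) \<Rightarrow> 'a"
  where "elem_sym R k I b = (\<Oplus>\<^bsub>R\<^esub>T\<in>{T. T \<subseteq> I \<and> card T = k}. \<Otimes>\<^bsub>R\<^esub>i\<in>T. b i)"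

context cring
begin

lemma elem_sym_closed [simp, intro]:
  "b \<in> I \<rightarrow> carrier R \<Longrightarrow> elem_sym R k I b \<in> carrier R"
  unfolding elem_sym_def by (intro finsum_closed funcsetI finprod_closed) blast

lemma elem_sym_0: "finite I \<Longrightarrow> elem_sym R 0 I b = \<one>"
proof -
  assume "finite I"
  then have "card T = 0 \<longleftrightarrow> T = {}" if "T \<subseteq> I" for T
    using that by (simp add: finite_subset[OF that])
  then have "{T. T \<subseteq> I \<and> card T = 0} = {{}}" by auto
  then show ?thesis by (simp add: elem_sym_def)
qed

lemma elem_sym_gt_card:
  assumes "finite I" "k > card I"
  shows "elem_sym R k I b = \<zero>"
proof -
  have "{T. T \<subseteq> I \<and> card T = k} = {}"
    using assms card_mono[of I] leD by auto
  then show ?thesis unfolding elem_sym_def by (simp only: finsum_empty)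
qed

text \<open>Sort the subsets of \<open>insert j I\<close> by whether they contain \<open>j\<close>.\<close>

lemma elem_sym_insert:
  assumes I: "finite I" "j \<notin> I" and b: "b \<in> insert j I \<rightarrow> carrier R"
  shows "elem_sym R (Suc k) (insert j I) b = elem_sym R (Suc k) I b \<oplus> b j \<otimes> elem_sym R k I b"
proof -
  let ?P = "\<lambda>k. {T. T \<subseteq> I \<and> card T = k}"
  have fin: "finite (?P k)" for k using I by simp
  have finT: "finite T" if "T \<in> ?P k" for T k using that I finite_subset by blast
  have split: "{T. T \<subseteq> insert j I \<and> card T = Suc k} = ?P (Suc k) \<union> insert j ` ?P k"
  proof (intro Set.set_eqI iffI)
    fix T assume T: "T \<in> {T. T \<subseteq> insert j I \<and> card T = Suc k}"
    then have "finite T" by (intro card_ge_0_finite) simp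
    show "T \<in> ?P (Suc k) \<union> insert j ` ?P k"
    proof (cases "j \<in> T")
      case True
      then have "T = insert j (T - {j})" by (rule insert_Diff[symmetric])
      moreover have "T - {j} \<subseteq> I" "card (T - {j}) = k"
        using T True \<open>finite T\<close> by (blast, simp)
      ultimately show ?thesis by blast
    next
      case False
      then show ?thesis using T by blast
    qed
  next
    fix T assume "T \<in> ?P (Suc k) \<union> insert j ` ?P k"
    then show "T \<in> {T. T \<subseteq> insert j I \<and> card T = Suc k}"
    proof
      assume "T \<in> insert j ` ?P k"
      then obtain U where U: "T = insert j U" "U \<in> ?P k" by blast
      then have "finite U" "j \<notin> U" using I finT by blast+
      then show ?thesis using U by auto
    qed blast
  qed
  have inj: "inj_on (insert j) (?P k)"
  proof (rule inj_onI)
    fix T U assume "T \<in> ?P k" "U \<in> ?P k" "insert j T = insert j U"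
    then show "T = U" using I(2) insert_ident[of j T U] by blast
  qed
  have bT: "b \<in> T \<rightarrow> carrier R" if "T \<subseteq> insert j I" for T using that b by blast
  have prod: "(\<lambda>T. \<Otimes>i\<in>T. b i) \<in> A \<rightarrow> carrier R" if "A \<subseteq> Pow (insert j I)" for A
  proof (rule funcsetI)
    fix T assume "T \<in> A"
    then have "T \<subseteq> insert j I" using that by auto
    then show "(\<Otimes>i\<in>T. b i) \<in> carrier R" by (intro finprod_closed bT)
  qed
  have "elem_sym R (Suc k) (insert j I) b =
      elem_sym R (Suc k) I b \<oplus> (\<Oplus>T\<in>insert j ` ?P k. \<Otimes>i\<in>T. b i)"
    unfolding elem_sym_def split
  proof (rule finsum_Un_disjoint)
    show "?P (Suc k) \<inter> insert j ` ?P k = {}" using I(2) by blast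
    show "finite (?P (Suc k))" "finite (insert j ` ?P k)" using fin by auto
  qed (rule prod; auto)+
  also have "(\<Oplus>T\<in>insert j ` ?P k. \<Otimes>i\<in>T. b i) = (\<Oplus>T\<in>?P k. \<Otimes>i\<in>insert j T. b i)"
    by (intro finsum_reindex inj prod) auto
  also have "\<dots> = (\<Oplus>T\<in>?P k. b j \<otimes> (\<Otimes>i\<in>T. b i))"
  proof (rule finsum_cong')
    fix T assume T: "T \<in> ?P k"
    then have "j \<notin> T" "T \<subseteq> insert j I" using I(2) by auto
    moreover have "b j \<in> carrier R" using b by auto
    ultimately show "(\<Otimes>i\<in>insert j T. b i) = b j \<otimes> (\<Otimes>i\<in>T. b i)"
      using finT[OF T] bT[of T] by simp
  next
    show "(\<lambda>T. b j \<otimes> (\<Otimes>i\<in>T. b i)) \<in> ?P k \<rightarrow> carrier R"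
      using b by (intro funcsetI m_closed finprod_closed bT) auto
  qed (rule refl)
  also have "\<dots> = b j \<otimes> elem_sym R k I b"
    unfolding elem_sym_def using b by (intro finsum_rdistr[symmetric] fin prod) auto
  finally show ?thesis .
qed

lemma finprod_add_eq_elem_sym:
  assumes "finite I" "b \<in> I \<rightarrow> carrier R" and x: "x \<in> carrier R"
  shows "(\<Otimes>i\<in>I. x \<oplus> b i) = (\<Oplus>k\<in>{..card I}. elem_sym R k I b \<otimes> x [^] (card I - k))"
  using assms(1,2)
proof (induction I rule: finite_induct)
  case empty
  then show ?case by (simp add: elem_sym_0)
next
  case (insert j I)
  let ?m = "card I"
  let ?e = "\<lambda>k. elem_sym R k I b"
  have b: "b j \<in> carrier R" "b \<in> I \<rightarrow> carrier R" using insert by auto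
  note ec = elem_sym_closed[OF b(2)]
  have "(\<Otimes>i\<in>insert j I. x \<oplus> b i) = (x \<oplus> b j) \<otimes> (\<Oplus>k\<in>{..?m}. ?e k \<otimes> x [^] (?m - k))"
    using insert b x by (subst finprod_insert) auto
  also have "\<dots> = x \<otimes> (\<Oplus>k\<in>{..?m}. ?e k \<otimes> x [^] (?m - k))
      \<oplus> b j \<otimes> (\<Oplus>k\<in>{..?m}. ?e k \<otimes> x [^] (?m - k))"
    using b x ec by (intro l_distr finsum_closed) auto
  also have "x \<otimes> (\<Oplus>k\<in>{..?m}. ?e k \<otimes> x [^] (?m - k)) =
      (\<Oplus>k\<in>{..?m}. ?e k \<otimes> x [^] (Suc ?m - k))"
  proof -
    have "x \<otimes> (?e k \<otimes> x [^] (?m - k)) = ?e k \<otimes> x [^] (Suc ?m - k)" if "k \<le> ?m" for k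
      using that x ec by (simp add: Suc_diff_le m_lcomm m_comm)
    then show ?thesis
      using x ec by (subst finsum_rdistr) (auto intro!: finsum_cong')
  qed
  \<comment> \<open>The sum can be extended to \<open>k = Suc ?m\<close> because that elementary symmetric function vanishes; then
    splitting off \<open>k = 0\<close> shifts the index.\<close>
  also have "\<dots> = x [^] Suc ?m \<oplus> (\<Oplus>k\<in>{..?m}. ?e (Suc k) \<otimes> x [^] (?m - k))"
  proof -
    have "(\<Oplus>k\<in>{..Suc ?m}. ?e k \<otimes> x [^] (Suc ?m - k)) =
        (\<Oplus>k\<in>{..?m}. ?e k \<otimes> x [^] (Suc ?m - k))"
      using x ec insert(1) by (subst finsum_Suc) (auto simp: elem_sym_gt_card finsum_closed)
    moreover have "(\<Oplus>k\<in>{..Suc ?m}. ?e k \<otimes> x [^] (Suc ?m - k)) =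
        (\<Oplus>k\<in>{..?m}. ?e (Suc k) \<otimes> x [^] (?m - k)) \<oplus> x [^] Suc ?m"
      using x ec insert(1) by (subst finsum_Suc2) (auto simp: elem_sym_0)
    ultimately show ?thesis using x ec by (simp add: a_comm finsum_closed)
  qed
  also have "b j \<otimes> (\<Oplus>k\<in>{..?m}. ?e k \<otimes> x [^] (?m - k)) =
      (\<Oplus>k\<in>{..?m}. b j \<otimes> ?e k \<otimes> x [^] (?m - k))"
    using x b ec by (subst finsum_rdistr) (auto simp: m_assoc)
  also have "x [^] Suc ?m \<oplus> (\<Oplus>k\<in>{..?m}. ?e (Suc k) \<otimes> x [^] (?m - k)) \<oplus>
        (\<Oplus>k\<in>{..?m}. b j \<otimes> ?e k \<otimes> x [^] (?m - k)) =
      (\<Oplus>k\<in>{..?m}. ?e (Suc k) \<otimes> x [^] (?m - k) \<oplus> b j \<otimes> ?e k \<otimes> x [^] (?m - k)) \<oplus> x [^] Suc ?m"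
    using x b ec by (subst finsum_addf) (auto simp: a_ac finsum_closed)
  also have "(\<Oplus>k\<in>{..?m}. ?e (Suc k) \<otimes> x [^] (?m - k) \<oplus> b j \<otimes> ?e k \<otimes> x [^] (?m - k)) =
      (\<Oplus>k\<in>{..?m}. elem_sym R (Suc k) (insert j I) b \<otimes> x [^] (?m - k))"
    using x b ec insert by (intro finsum_cong') (auto simp: elem_sym_insert l_distr)
  also have "\<dots> \<oplus> x [^] Suc ?m =
      (\<Oplus>k\<in>{..Suc ?m}. elem_sym R k (insert j I) b \<otimes> x [^] (Suc ?m - k))"
    using x insert by (subst finsum_Suc2) (auto simp: elem_sym_0)
  finally show ?case using insert by simp
qed

lemma elem_sym_permute:
  assumes f: "bij_betw f I I" and b: "b \<in> I \<rightarrow> carrier R"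
  shows "elem_sym R k I (\<lambda>i. b (f i)) = elem_sym R k I b"
proof -
  let ?P = "{T. T \<subseteq> I \<and> card T = k}"
  have inj: "inj_on f I" and im: "f ` I = I" using f by (auto simp: bij_betw_def)
  have bT: "b \<in> T \<rightarrow> carrier R" if "T \<subseteq> I" for T using that b by blast
  have imP: "(`) f ` ?P = ?P"
  proof (intro equalityI subsetI)
    fix T assume "T \<in> (`) f ` ?P"
    then show "T \<in> ?P" using inj im by (auto simp: card_image inj_on_subset)
  next
    fix T assume T: "T \<in> ?P"
    then obtain U where U: "U \<subseteq> I" "T = f ` U" using im by (metis mem_Collect_eq subset_image_iff)
    then have "U \<in> ?P" using T inj by (auto simp: card_image inj_on_subset)
    then show "T \<in> (`) f ` ?P" using U by blast
  qed
  have "elem_sym R k I b = (\<Oplus>T\<in>(`) f ` ?P. \<Otimes>i\<in>T. b i)"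
    by (simp add: elem_sym_def imP)
  also have "\<dots> = (\<Oplus>T\<in>?P. \<Otimes>i\<in>f ` T. b i)"
  proof (rule finsum_reindex)
    show "inj_on ((`) f) ?P"
      by (rule inj_on_subset[OF inj_on_image_Pow[OF inj]]) auto
    show "(\<lambda>T. \<Otimes>i\<in>T. b i) \<in> (`) f ` ?P \<rightarrow> carrier R"
      unfolding imP by (rule funcsetI, rule finprod_closed, rule bT) simp
  qed
  also have "\<dots> = (\<Oplus>T\<in>?P. \<Otimes>i\<in>T. b (f i))"
  proof (rule finsum_cong')
    fix T assume "T \<in> ?P"
    then have T: "f ` T \<subseteq> I" "inj_on f T" using im inj inj_on_subset by blast+
    then show "(\<Otimes>i\<in>f ` T. b i) = (\<Otimes>i\<in>T. b (f i))"
      by (intro finprod_reindex bT) simp_all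
  next
    show "(\<lambda>T. \<Otimes>i\<in>T. b (f i)) \<in> ?P \<rightarrow> carrier R"
      using im b by (intro funcsetI finprod_closed) auto
  qed (rule refl)
  finally show ?thesis by (simp add: elem_sym_def)
qed

text \<open>
  The binomial expansion is the case of a constant family in \<open>finprod_add_eq_elem_sym\<close>: there the
  \<open>k\<close>-th elementary symmetric function is \<open>p choose k\<close> times a power, and \<open>p\<close> divides
  the inner binomial coefficients.
\<close>

lemma add_pow_prime_char:
  assumes p: "prime (p::nat)" "[p] \<cdot> \<one> = \<zero>" and xy: "x \<in> carrier R" "y \<in> carrier R"
  shows "(x \<oplus> y) [^] p = x [^] p \<oplus> y [^] p"
proof -
  have e: "elem_sym R k {..<p} (\<lambda>_. y) = [(p choose k)] \<cdot> (y [^] k)" for k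
  proof -
    have "elem_sym R k {..<p} (\<lambda>_. y) = (\<Oplus>T\<in>{T. T \<subseteq> {..<p} \<and> card T = k}. y [^] k)"
      unfolding elem_sym_def using xy by (intro finsum_cong') (auto simp: finprod_const)
    then show ?thesis using xy by (simp add: add.finprod_const n_subsets)
  qed
  have e0: "[(p choose k)] \<cdot> (y [^] k) = \<zero>" if "0 < k" "k < p" for k
  proof -
    have "p dvd p choose k" using that p by (intro dvd_choose_prime) auto
    then obtain c where "p choose k = p * c" by blast
    then have "[(p choose k)] \<cdot> (y [^] k) = [p] \<cdot> \<one> \<otimes> [c] \<cdot> (y [^] k)"
      using xy by (simp add: add_pow_ldistr add.nat_pow_pow mult.commute)
    then show ?thesis using p xy by simp
  qed
  have "(x \<oplus> y) [^] p = (\<Otimes>i\<in>{..<p}. x \<oplus> y)" using xy by (simp add: finprod_const)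
  also have "\<dots> = (\<Oplus>k\<in>{..p}. [(p choose k)] \<cdot> (y [^] k) \<otimes> x [^] (p - k))"
    using xy by (subst finprod_add_eq_elem_sym) (auto simp: e)
  also have "\<dots> = (\<Oplus>k\<in>{0, p}. [(p choose k)] \<cdot> (y [^] k) \<otimes> x [^] (p - k))"
    using xy e0 by (intro add.finprod_mono_neutral_cong_right) (auto simp: neq0_conv)
  also have "\<dots> = x [^] p \<oplus> y [^] p" using xy p by (subst finsum_insert) auto
  finally show ?thesis .
qed
end

lemma (in ring_hom_cring) hom_elem_sym:
  assumes "b \<in> I \<rightarrow> carrier R"
  shows "h (elem_sym R k I b) = elem_sym S k I (\<lambda>i. h (b i))"
proof -
  let ?P = "{T. T \<subseteq> I \<and> card T = k}"
  have b: "b \<in> T \<rightarrow> carrier R" if "T \<in> ?P" for T using that assms by blast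
  have "h (elem_sym R k I b) = (\<Oplus>\<^bsub>S\<^esub>T\<in>?P. h (\<Otimes>i\<in>T. b i))"
    unfolding elem_sym_def by (subst hom_finsum) (auto simp: o_def intro!: R.finprod_closed b)
  also have "\<dots> = (\<Oplus>\<^bsub>S\<^esub>T\<in>?P. \<Otimes>\<^bsub>S\<^esub>i\<in>T. h (b i))"
    using b by (intro S.finsum_cong') (auto simp: hom_finprod o_def intro!: S.finprod_closed)
  finally show ?thesis by (simp add: elem_sym_def)
qed

section \<open>Rings of prime characteristic\<close>

lemma (in ring_hom_cring) hom_add_pow_one: "h ([(m::nat)] \<cdot> \<one>) = [m] \<cdot>\<^bsub>S\<^esub> \<one>\<^bsub>S\<^esub>"
  by (induction m) (simp_all add: R.add.nat_pow_Suc S.add.nat_pow_Suc)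

lemma (in ring_hom_cring) hom_pow: "x \<in> carrier R \<Longrightarrow> h (x [^] (k::nat)) = h x [^]\<^bsub>S\<^esub> k"
  by (induction k) simp_all

context cring
begin

lemma elem_sym_zero:
  assumes "k > 0"
  shows "elem_sym R k I (\<lambda>_. \<zero>) = \<zero>"
  unfolding elem_sym_def
proof (rule add.finprod_one_eqI)
  fix T assume "T \<in> {T. T \<subseteq> I \<and> card T = k}"
  then show "(\<Otimes>i\<in>T. \<zero>) = \<zero>" using assms by (simp add: finprod_const nat_pow_zero)
qed

lemma finsum_pow_prime_char:
  assumes p: "prime (p::nat)" "[p] \<cdot> \<one> = \<zero>" and "finite A" "f \<in> A \<rightarrow> carrier R"
  shows "(\<Oplus>i\<in>A. f i) [^] p = (\<Oplus>i\<in>A. f i [^] p)"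
  using assms(3,4)
proof (induction A rule: finite_induct)
  case empty
  then show ?case using p prime_gt_0_nat by (simp add: nat_pow_zero)
next
  case (insert j A)
  then have "f j \<in> carrier R" "f \<in> A \<rightarrow> carrier R" "(\<lambda>i. f i [^] p) \<in> A \<rightarrow> carrier R" by auto
  then show ?case using insert by (simp add: add_pow_prime_char[OF p])
qed

lemma add_pow_one_pow_prime_char:
  assumes p: "prime (p::nat)" "[p] \<cdot> \<one> = \<zero>"
  shows "([(m::nat)] \<cdot> \<one>) [^] p = [m] \<cdot> \<one>"
  using prime_gt_0_nat[OF p(1)]
  by (induction m) (simp_all add: nat_pow_zero add_pow_prime_char[OF p])

lemma dvd_if_add_pow_one_eq_zero:
  assumes p: "prime (p::nat)" "[p] \<cdot> \<one> = \<zero>" and nz: "\<one> \<noteq> \<zero>" and m: "[(m::nat)] \<cdot> \<one> = \<zero>"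
  shows "p dvd m"
proof (rule ccontr)
  assume "\<not> p dvd m"
  then have "coprime m p" using p(1) by (metis coprime_commute prime_imp_coprime)
  moreover have "m \<noteq> 0" using \<open>\<not> p dvd m\<close> by (metis dvd_0_right)
  ultimately obtain u v where uv: "m * u = p * v + 1" using bezout_nat[of m p] by auto
  have "[(m * u)] \<cdot> \<one> = \<zero>" "[(p * v)] \<cdot> \<one> = \<zero>"
    using p m by (simp_all flip: add.nat_pow_pow)
  then show False using nz by (simp add: uv)
qed

end

section \<open>Cyclic actions whose fixed ring is the prime ring\<close>

lemma bij_betw_Suc_mod: "bij_betw (\<lambda>i. Suc i mod d) {..<d} {..<d}"
proof -
  have "inj_on (\<lambda>i. Suc i mod d) {..<d}"
    by (rule inj_onI) (auto simp: mod_Suc split: if_splits)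
  moreover have "(\<lambda>i. Suc i mod d) ` {..<d} \<subseteq> {..<d}" by auto
  ultimately show ?thesis by (simp add: bij_betw_def endo_inj_surj)
qed

text \<open>
  The setting in which conjugates are compared under homomorphisms. The normal basis enters only through
  \<open>\<sigma>_fixed\<close>, and the characteristic of the ring is left arbitrary.
\<close>

locale cyclic_over_prime_ring = cring +
  fixes \<sigma> :: "'a \<Rightarrow> 'a" and d :: nat
  assumes \<sigma>_hom: "\<sigma> \<in> ring_hom R R"
    and d_pos: "d > 0"
    and \<sigma>_period: "x \<in> carrier R \<Longrightarrow> (\<sigma> ^^ d) x = x"
    and \<sigma>_fixed: "x \<in> carrier R \<Longrightarrow> \<sigma> x = x \<Longrightarrow> \<exists>m::nat. x = [m] \<cdot> \<one>"
begin

sublocale \<sigma>: ring_hom_cring R R \<sigma>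
  by unfold_locales (rule \<sigma>_hom)

lemma conj_closed [simp, intro]: "x \<in> carrier R \<Longrightarrow> (\<sigma> ^^ i) x \<in> carrier R"
  by (induction i) simp_all

lemma conj_Suc_mod:
  assumes "x \<in> carrier R" "i < d"
  shows "(\<sigma> ^^ (Suc i mod d)) x = \<sigma> ((\<sigma> ^^ i) x)"
  using assms \<sigma>_period[of x] by (cases "Suc i = d") auto

text \<open>
  Applying \<open>\<sigma>\<close> to the coefficients shifts the conjugates cyclically, so the coefficients are fixed.
\<close>

lemma char_poly_coeff_in_prime_ring:
  assumes x: "x \<in> carrier R"
  shows "\<exists>m::nat. elem_sym R k {..<d} (\<lambda>i. \<ominus> (\<sigma> ^^ i) x) = [m] \<cdot> \<one>"
proof (rule \<sigma>_fixed)
  let ?b = "\<lambda>i. \<ominus> (\<sigma> ^^ i) x"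
  have "\<sigma> (elem_sym R k {..<d} ?b) = elem_sym R k {..<d} (\<lambda>i. \<sigma> (?b i))"
    using x by (intro \<sigma>.hom_elem_sym) auto
  also have "\<dots> = elem_sym R k {..<d} (\<lambda>i. ?b (Suc i mod d))"
  proof -
    have "(\<Otimes>i\<in>T. \<sigma> (?b i)) = (\<Otimes>i\<in>T. ?b (Suc i mod d))" if "T \<subseteq> {..<d}" for T
      using that x by (intro finprod_cong') (auto simp: conj_Suc_mod subset_iff)
    then show ?thesis
      unfolding elem_sym_def using x by (intro finsum_cong') (auto intro!: finprod_closed)
  qed
  also have "\<dots> = elem_sym R k {..<d} ?b"
    using x by (intro elem_sym_permute[OF bij_betw_Suc_mod]) auto
  finally show "\<sigma> (elem_sym R k {..<d} ?b) = elem_sym R k {..<d} ?b" .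
qed (use x in auto)

text \<open>The factor with \<open>i = 0\<close> vanishes at \<open>x\<close>.\<close>

lemma char_poly_root:
  assumes x: "x \<in> carrier R"
  shows "(\<Oplus>k\<in>{..d}. elem_sym R k {..<d} (\<lambda>i. \<ominus> (\<sigma> ^^ i) x) \<otimes> x [^] (d - k)) = \<zero>"
proof -
  have d: "{..<d} = insert 0 {1..<d}" using d_pos by auto
  have "(\<Otimes>i\<in>{..<d}. x \<oplus> \<ominus> (\<sigma> ^^ i) x) = \<zero>"
    unfolding d using x by (subst finprod_insert) (auto simp: r_neg)
  then show ?thesis using x by (subst (asm) finprod_add_eq_elem_sym) auto
qed

text \<open>
  In the application, \<open>h\<close> is reduction modulo a maximal ideal and \<open>g\<close> reduction modulo \<open>p\<close>. The two are compared through
  the coefficients of the polynomial of the conjugates of \<open>a\<close>: these are integers, and an integer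
  vanishing in \<open>K\<close> is divisible by \<open>p\<close>, so it vanishes in \<open>L\<close> too. Only the leading term
  of the equation of \<open>a\<close> survives in \<open>L\<close>, which makes \<open>g a\<close> nilpotent.
\<close>

lemma vanishes_if_conjugates_vanish:
  assumes "ring_hom_cring R K h" "ring_hom_cring R L g"
    and p: "prime (p::nat)" "[p] \<cdot>\<^bsub>K\<^esub> \<one>\<^bsub>K\<^esub> = \<zero>\<^bsub>K\<^esub>" "[p] \<cdot>\<^bsub>L\<^esub> \<one>\<^bsub>L\<^esub> = \<zero>\<^bsub>L\<^esub>"
    and K: "\<one>\<^bsub>K\<^esub> \<noteq> \<zero>\<^bsub>K\<^esub>" and L: "reduced_ring L"
    and a: "a \<in> carrier R" "\<And>i. h ((\<sigma> ^^ i) a) = \<zero>\<^bsub>K\<^esub>"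
  shows "g a = \<zero>\<^bsub>L\<^esub>"
proof -
  interpret h: ring_hom_cring R K h by fact
  interpret g: ring_hom_cring R L g by fact
  let ?e = "\<lambda>k. elem_sym R k {..<d} (\<lambda>i. \<ominus> (\<sigma> ^^ i) a)"
  have e: "?e k \<in> carrier R" for k using a by auto
  have ge: "g (?e k) = \<zero>\<^bsub>L\<^esub>" if k: "k > 0" for k
  proof -
    obtain m :: nat where m: "?e k = [m] \<cdot> \<one>" using char_poly_coeff_in_prime_ring[OF a(1)] by blast
    have "h (?e k) = elem_sym K k {..<d} (\<lambda>_. \<zero>\<^bsub>K\<^esub>)"
      using a by (subst h.hom_elem_sym) auto
    then have "[m] \<cdot>\<^bsub>K\<^esub> \<one>\<^bsub>K\<^esub> = \<zero>\<^bsub>K\<^esub>"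
      using k m h.S.elem_sym_zero h.hom_add_pow_one by metis
    then have "p dvd m" using h.S.dvd_if_add_pow_one_eq_zero p K by blast
    then obtain c where "m = p * c" by blast
    then have "[m] \<cdot>\<^bsub>L\<^esub> \<one>\<^bsub>L\<^esub> = \<zero>\<^bsub>L\<^esub>" using p by (simp flip: g.S.add.nat_pow_pow)
    then show ?thesis using m g.hom_add_pow_one by simp
  qed
  have "\<zero>\<^bsub>L\<^esub> = g (\<Oplus>k\<in>{..d}. ?e k \<otimes> a [^] (d - k))"
    using char_poly_root[OF a(1)] by simp
  also have "\<dots> = (\<Oplus>\<^bsub>L\<^esub>k\<in>{..d}. g (?e k) \<otimes>\<^bsub>L\<^esub> g a [^]\<^bsub>L\<^esub> (d - k))"
    using a e by (subst g.hom_finsum) (auto intro!: g.S.finsum_cong' simp: g.hom_pow)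
  also have "\<dots> = (\<Oplus>\<^bsub>L\<^esub>k\<in>{0}. g (?e k) \<otimes>\<^bsub>L\<^esub> g a [^]\<^bsub>L\<^esub> (d - k))"
    using a e ge by (intro g.S.add.finprod_mono_neutral_cong_right) auto
  also have "\<dots> = g a [^]\<^bsub>L\<^esub> d"
    using a by (simp add: elem_sym_0)
  finally show ?thesis using L a unfolding reduced_ring_def by (metis g.hom_closed)
qed

text \<open>
  In a domain of characteristic \<open>p\<close>, raising to the power \<open>p\<close> maps roots of a polynomial over the prime
  field to roots of the same polynomial, and the roots of the one at hand are the conjugates of \<open>x\<close>.
\<close>

lemma frobenius_is_conjugate:
  assumes "ring_hom_cring R K h" "domain K"
    and p: "prime (p::nat)" "[p] \<cdot>\<^bsub>K\<^esub> \<one>\<^bsub>K\<^esub> = \<zero>\<^bsub>K\<^esub>"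
    and x: "x \<in> carrier R"
  shows "\<exists>i<d. h x [^]\<^bsub>K\<^esub> p = h ((\<sigma> ^^ i) x)"
proof -
  interpret h: ring_hom_cring R K h by fact
  interpret K: "domain" K by fact
  let ?b = "\<lambda>i. \<ominus> (\<sigma> ^^ i) x"
  let ?e = "\<lambda>k. elem_sym R k {..<d} ?b"
  have e: "?e k \<in> carrier R" for k using x by auto
  have e_pow: "h (?e k) [^]\<^bsub>K\<^esub> p = h (?e k)" for k
    using char_poly_coeff_in_prime_ring[OF x, of k] h.hom_add_pow_one h.S.add_pow_one_pow_prime_char[OF p]
    by metis
  have "(\<Otimes>\<^bsub>K\<^esub>i\<in>{..<d}. h x [^]\<^bsub>K\<^esub> p \<oplus>\<^bsub>K\<^esub> h (?b i)) =
      (\<Oplus>\<^bsub>K\<^esub>k\<in>{..d}. h (?e k) \<otimes>\<^bsub>K\<^esub> (h x [^]\<^bsub>K\<^esub> p) [^]\<^bsub>K\<^esub> (d - k))"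
    using x by (subst h.S.finprod_add_eq_elem_sym) (auto simp: h.hom_elem_sym)
  also have "\<dots> = (\<Oplus>\<^bsub>K\<^esub>k\<in>{..d}. (h (?e k) \<otimes>\<^bsub>K\<^esub> h x [^]\<^bsub>K\<^esub> (d - k)) [^]\<^bsub>K\<^esub> p)"
    using x e by (intro h.S.finsum_cong')
      (auto simp: e_pow h.S.nat_pow_distrib h.S.nat_pow_pow mult.commute)
  also have "\<dots> = (\<Oplus>\<^bsub>K\<^esub>k\<in>{..d}. h (?e k) \<otimes>\<^bsub>K\<^esub> h x [^]\<^bsub>K\<^esub> (d - k)) [^]\<^bsub>K\<^esub> p"
    using x e by (intro h.S.finsum_pow_prime_char[symmetric] p) auto
  also have "(\<Oplus>\<^bsub>K\<^esub>k\<in>{..d}. h (?e k) \<otimes>\<^bsub>K\<^esub> h x [^]\<^bsub>K\<^esub> (d - k)) =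
      h (\<Oplus>k\<in>{..d}. ?e k \<otimes> x [^] (d - k))"
    using x e by (subst h.hom_finsum) (auto intro!: h.S.finsum_cong' simp: h.hom_pow)
  also have "\<dots> [^]\<^bsub>K\<^esub> p = \<zero>\<^bsub>K\<^esub>"
    using char_poly_root[OF x] prime_gt_0_nat[OF p(1)] by (simp add: h.S.nat_pow_zero)
  finally have prod0: "(\<Otimes>\<^bsub>K\<^esub>i\<in>{..<d}. h x [^]\<^bsub>K\<^esub> p \<oplus>\<^bsub>K\<^esub> h (?b i)) = \<zero>\<^bsub>K\<^esub>" .
  have "\<exists>i\<in>I. f i = \<zero>\<^bsub>K\<^esub>"
    if "finite I" "f \<in> I \<rightarrow> carrier K" "(\<Otimes>\<^bsub>K\<^esub>i\<in>I. f i) = \<zero>\<^bsub>K\<^esub>" for f and I :: "nat set"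
    using that by (induction I rule: finite_induct) (auto simp: K.integral_iff)
  from this[OF _ _ prod0] obtain i where i: "i < d" "h x [^]\<^bsub>K\<^esub> p \<oplus>\<^bsub>K\<^esub> h (?b i) = \<zero>\<^bsub>K\<^esub>"
    using x by auto
  then have "h x [^]\<^bsub>K\<^esub> p \<ominus>\<^bsub>K\<^esub> h ((\<sigma> ^^ i) x) = \<zero>\<^bsub>K\<^esub>" using x by (simp add: a_minus_def)
  then have "h x [^]\<^bsub>K\<^esub> p = h ((\<sigma> ^^ i) x)" using x by (simp add: h.S.r_right_minus_eq)
  then show ?thesis using i by blast
qed

end

text \<open>
  The order \<open>r\<close> is measured in \<open>L\<close>, while Frobenius is understood only in the domain \<open>K\<close>. The step
  \<open>dvd\<close> carries relations from \<open>K\<close> to \<open>L\<close>: if \<open>\<theta>\<^sup>m\<close> becomes \<open>1\<close> in \<open>K\<close>, so do all its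
  conjugates, since they are powers of it.
\<close>

lemma (in cyclic_over_prime_ring) exponents_cong_order:
  assumes "ring_hom_cring R K h" "domain K" "ring_hom_cring R L g"
    and p: "prime (p::nat)" "[p] \<cdot>\<^bsub>K\<^esub> \<one>\<^bsub>K\<^esub> = \<zero>\<^bsub>K\<^esub>" "[p] \<cdot>\<^bsub>L\<^esub> \<one>\<^bsub>L\<^esub> = \<zero>\<^bsub>L\<^esub>"
    and L: "reduced_ring L"
    and \<theta>: "\<theta> \<in> Units R" "\<theta> [^] (n::nat) = \<sigma> \<theta>"
    and r: "\<And>k::nat. g \<theta> [^]\<^bsub>L\<^esub> k = \<one>\<^bsub>L\<^esub> \<longleftrightarrow> r dvd k"
  shows "[n ^ d = 1] (mod r)" and "\<exists>z. [p = n ^ z] (mod r)"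
proof -
  interpret h: ring_hom_cring R K h by fact
  interpret g: ring_hom_cring R L g by fact
  interpret K: "domain" K by fact
  have \<theta>c: "\<theta> \<in> carrier R" using \<theta>(1) by (rule Units_closed)
  have conj: "(\<sigma> ^^ i) \<theta> = \<theta> [^] (n ^ i)" for i
    by (induction i) (use \<theta>c in \<open>simp_all add: \<sigma>.hom_pow \<theta>(2)[symmetric] nat_pow_pow\<close>)
  have conj': "(\<sigma> ^^ i) (\<theta> [^] m \<ominus> \<one>) = \<theta> [^] (m * n ^ i) \<ominus> \<one>" for i and m :: nat
    by (induction i) (use \<theta>c in
      \<open>simp_all add: a_minus_def \<sigma>.hom_pow \<theta>(2)[symmetric] nat_pow_pow mult_ac\<close>)
  have h\<theta>: "h \<theta> \<in> Units K"
  proof -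
    have "h \<theta> \<otimes>\<^bsub>K\<^esub> h (inv \<theta>) = \<one>\<^bsub>K\<^esub>" using \<theta> \<theta>c by (simp flip: h.hom_mult)
    moreover from this have "h (inv \<theta>) \<otimes>\<^bsub>K\<^esub> h \<theta> = \<one>\<^bsub>K\<^esub>"
      using \<theta> \<theta>c by (subst h.S.m_comm) simp_all
    moreover have "h \<theta> \<in> carrier K" "h (inv \<theta>) \<in> carrier K" using \<theta> \<theta>c by simp_all
    ultimately show ?thesis unfolding Units_def by blast
  qed
  have dvd: "r dvd m" if "h \<theta> [^]\<^bsub>K\<^esub> m = \<one>\<^bsub>K\<^esub>" for m :: nat
  proof -
    have "g (\<theta> [^] m \<ominus> \<one>) = \<zero>\<^bsub>L\<^esub>"
    proof (rule vanishes_if_conjugates_vanish[OF assms(1,3) p _ L])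
      fix i
      have "h (\<theta> [^] (m * n ^ i)) = \<one>\<^bsub>K\<^esub>"
        using \<theta>c that h\<theta> by (simp add: h.hom_pow h.S.nat_pow_pow[symmetric])
      then show "h ((\<sigma> ^^ i) (\<theta> [^] m \<ominus> \<one>)) = \<zero>\<^bsub>K\<^esub>"
        unfolding conj' using \<theta>c by (simp add: a_minus_def h.S.r_neg)
    qed (use \<theta>c in simp_all)
    then have "g \<theta> [^]\<^bsub>L\<^esub> m \<ominus>\<^bsub>L\<^esub> \<one>\<^bsub>L\<^esub> = \<zero>\<^bsub>L\<^esub>"
      using \<theta>c by (simp add: a_minus_def g.hom_pow)
    then have "g \<theta> [^]\<^bsub>L\<^esub> m = \<one>\<^bsub>L\<^esub>" using \<theta>c by simp
    then show ?thesis using \<theta>c r by simp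
  qed
  have le: "[u = v] (mod r)" if "h \<theta> [^]\<^bsub>K\<^esub> u = h \<theta> [^]\<^bsub>K\<^esub> v" "u \<le> v" for u v :: nat
  proof -
    obtain m where m: "v = u + m" using \<open>u \<le> v\<close> le_Suc_ex by blast
    have "h \<theta> [^]\<^bsub>K\<^esub> u \<otimes>\<^bsub>K\<^esub> h \<theta> [^]\<^bsub>K\<^esub> m = h \<theta> [^]\<^bsub>K\<^esub> u \<otimes>\<^bsub>K\<^esub> \<one>\<^bsub>K\<^esub>"
      using that(1) \<theta>c by (simp add: m flip: h.S.nat_pow_mult)
    then have "h \<theta> [^]\<^bsub>K\<^esub> m = \<one>\<^bsub>K\<^esub>"
      using h\<theta> \<theta>c by (subst (asm) h.S.Units_l_cancel) (auto intro: h.S.Units_pow_closed)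
    then have "r dvd m" by (rule dvd)
    then obtain c where "m = r * c" by blast
    then show ?thesis by (simp add: m cong_def)
  qed
  have key: "[u = v] (mod r)" if "h \<theta> [^]\<^bsub>K\<^esub> u = h \<theta> [^]\<^bsub>K\<^esub> v" for u v :: nat
    using le[of u v] le[of v u] that by (cases "u \<le> v") (simp_all add: cong_sym)
  have "h \<theta> [^]\<^bsub>K\<^esub> (n ^ d) = h \<theta> [^]\<^bsub>K\<^esub> (1::nat)"
    using \<sigma>_period[OF \<theta>c] \<theta>c by (simp add: conj flip: h.hom_pow)
  then show "[n ^ d = 1] (mod r)" by (rule key)
  obtain i where "h \<theta> [^]\<^bsub>K\<^esub> p = h ((\<sigma> ^^ i) \<theta>)"
    using frobenius_is_conjugate[OF assms(1,2) p(1,2) \<theta>c] by blast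
  then have "h \<theta> [^]\<^bsub>K\<^esub> p = h \<theta> [^]\<^bsub>K\<^esub> (n ^ i)" using \<theta>c by (simp add: conj h.hom_pow)
  then show "\<exists>z. [p = n ^ z] (mod r)" using key by blast
qed

section \<open>The fixed ring of a normal basis\<close>

lemma finite_carrier_if_basis:
  assumes "finite (carrier R)" "is_basis R M d b"
  shows "finite (carrier M)"
proof (rule finite_subset)
  let ?F = "\<lambda>c. \<Oplus>\<^bsub>M\<^esub>i\<in>{..<d}. c i \<odot>\<^bsub>M\<^esub> b i"
  show "carrier M \<subseteq> ?F ` ({..<d} \<rightarrow>\<^sub>E carrier R)"
    using assms(2) unfolding is_basis_def by blast
  show "finite (?F ` ({..<d} \<rightarrow>\<^sub>E carrier R))"
    using assms(1) by (intro finite_imageI finite_PiE) auto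
qed

text \<open>
  Comparing coordinates, a fixed point has all its coordinates equal, so it is a multiple of the trace
  \<open>T\<close> of the generator \<open>\<omega>\<close>. In particular \<open>1 = uT\<close> and \<open>T\<^sup>2 = eT\<close> for scalars \<open>u\<close> and \<open>e\<close>, whence
  \<open>T = uT\<^sup>2 = e(uT) = e\<close> is a scalar itself.
\<close>

lemma fixed_point_of_normal_basis_is_scalar:
  assumes alg: "algebra R M" and d: "d > 0"
    and hom: "\<sigma> \<in> ring_hom M M"
    and lin: "\<And>r x. r \<in> carrier R \<Longrightarrow> x \<in> carrier M \<Longrightarrow> \<sigma> (r \<odot>\<^bsub>M\<^esub> x) = r \<odot>\<^bsub>M\<^esub> \<sigma> x"
    and period: "\<And>x. x \<in> carrier M \<Longrightarrow> (\<sigma> ^^ d) x = x"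
    and basis: "is_basis R M d (\<lambda>i. (\<sigma> ^^ i) \<omega>)"
    and x: "x \<in> carrier M" "\<sigma> x = x"
  shows "\<exists>c\<in>carrier R. x = c \<odot>\<^bsub>M\<^esub> \<one>\<^bsub>M\<^esub>"
proof -
  interpret S: cring M using alg by (rule algebra.M_cring)
  interpret \<sigma>: ring_hom_cring M M \<sigma> by unfold_locales (rule hom)
  interpret A: algebra R M by fact
  let ?b = "\<lambda>i. (\<sigma> ^^ i) \<omega>"
  have \<omega>: "\<omega> \<in> carrier M" using basis d unfolding is_basis_def by (metis funpow_0)
  have b: "?b i \<in> carrier M" for i using \<omega> by (induction i) simp_all
  define T where "T = (\<Oplus>\<^bsub>M\<^esub>i\<in>{..<d}. ?b i)"
  have T: "T \<in> carrier M" unfolding T_def using b by (intro S.finsum_closed) auto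
  let ?s = "\<lambda>i. Suc i mod d"
  have b_s: "?b (?s i) = \<sigma> (?b i)" if "i < d" for i
    using that period[OF \<omega>] by (cases "Suc i = d") auto
  have shift: "(\<Oplus>\<^bsub>M\<^esub>i\<in>{..<d}. f i) = (\<Oplus>\<^bsub>M\<^esub>i\<in>{..<d}. f (?s i))" if "f \<in> {..<d} \<rightarrow> carrier M" for f
  proof -
    have "inj_on ?s {..<d}" "?s ` {..<d} = {..<d}"
      using bij_betw_Suc_mod[of d] by (simp_all add: bij_betw_def)
    then show ?thesis using S.finsum_reindex[of f ?s "{..<d}"] that by simp
  qed
  have \<sigma>T: "\<sigma> T = T"
  proof -
    have "\<sigma> T = (\<Oplus>\<^bsub>M\<^esub>i\<in>{..<d}. \<sigma> (?b i))"
      unfolding T_def using b by (subst \<sigma>.hom_finsum) (auto simp: o_def)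
    also have "\<dots> = (\<Oplus>\<^bsub>M\<^esub>i\<in>{..<d}. ?b (?s i))"
      using b by (intro S.finsum_cong') (auto simp del: funpow.simps simp: b_s)
    also have "\<dots> = T" unfolding T_def using b by (intro shift[symmetric]) auto
    finally show ?thesis .
  qed
  have mult_T: "\<exists>c\<in>carrier R. y = c \<odot>\<^bsub>M\<^esub> T" if y: "y \<in> carrier M" "\<sigma> y = y" for y
  proof -
    define rep where "rep c \<longleftrightarrow> c \<in> {..<d} \<rightarrow>\<^sub>E carrier R \<and> y = (\<Oplus>\<^bsub>M\<^esub>i\<in>{..<d}. c i \<odot>\<^bsub>M\<^esub> ?b i)" for c
    have "\<exists>!c. rep c" using basis y(1) unfolding is_basis_def rep_def by simp
    then obtain c where "rep c" and uniq: "\<And>c'. rep c' \<Longrightarrow> c' = c" by blast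
    then have c: "c \<in> {..<d} \<rightarrow>\<^sub>E carrier R" and yc: "y = (\<Oplus>\<^bsub>M\<^esub>i\<in>{..<d}. c i \<odot>\<^bsub>M\<^esub> ?b i)"
      unfolding rep_def by auto
    have ci: "c i \<in> carrier R" if "i < d" for i using c that by auto
    \<comment> \<open>The coordinates of \<open>\<sigma> y\<close>: those of \<open>y\<close> shifted cyclically by one place.\<close>
    define c' where "c' = (\<lambda>i\<in>{..<d}. c (if i = 0 then d - 1 else i - 1))"
    have c'_s: "c' (?s i) = c i" if "i < d" for i
      using that d by (cases "Suc i = d") (auto simp: c'_def)
    have c': "c' \<in> {..<d} \<rightarrow>\<^sub>E carrier R" unfolding c'_def using ci d by auto
    then have c'i: "c' i \<in> carrier R" if "i < d" for i using that by auto
    have "y = (\<Oplus>\<^bsub>M\<^esub>i\<in>{..<d}. \<sigma> (c i \<odot>\<^bsub>M\<^esub> ?b i))"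
      using y(2) b ci unfolding yc by (subst (asm) \<sigma>.hom_finsum) (auto simp: o_def)
    also have "\<dots> = (\<Oplus>\<^bsub>M\<^esub>i\<in>{..<d}. c' (?s i) \<odot>\<^bsub>M\<^esub> ?b (?s i))"
      using b ci by (intro S.finsum_cong') (auto simp del: funpow.simps simp: b_s c'_s lin)
    also have "\<dots> = (\<Oplus>\<^bsub>M\<^esub>i\<in>{..<d}. c' i \<odot>\<^bsub>M\<^esub> ?b i)"
      using b c'i by (intro shift[symmetric]) auto
    finally have "c' = c" using c' uniq unfolding rep_def by simp
    have const: "c i = c 0" if "i < d" for i
      using that
    proof (induction i)
      case (Suc i)
      then have "c (Suc i) = c' (Suc i)" using \<open>c' = c\<close> by simp
      also have "\<dots> = c i" using Suc.prems by (simp add: c'_def)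
      finally show ?case using Suc by simp
    qed simp
    have "y = (\<Oplus>\<^bsub>M\<^esub>i\<in>{..<d}. c 0 \<odot>\<^bsub>M\<^esub> ?b i)"
      unfolding yc
    proof (rule S.finsum_cong')
      fix i assume "i \<in> {..<d}"
      then have "c i = c 0" using const by blast
      then show "c i \<odot>\<^bsub>M\<^esub> ?b i = c 0 \<odot>\<^bsub>M\<^esub> ?b i" by (rule arg_cong)
    qed (use b ci d in auto)
    also have "\<dots> = c 0 \<odot>\<^bsub>M\<^esub> T"
      unfolding T_def using b ci d by (intro A.finsum_smult_ldistr[symmetric]) auto
    finally show ?thesis using ci d by blast
  qed
  obtain u where u: "u \<in> carrier R" "\<one>\<^bsub>M\<^esub> = u \<odot>\<^bsub>M\<^esub> T" using mult_T[of "\<one>\<^bsub>M\<^esub>"] by auto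
  obtain e where e: "e \<in> carrier R" "T \<otimes>\<^bsub>M\<^esub> T = e \<odot>\<^bsub>M\<^esub> T"
    using mult_T[of "T \<otimes>\<^bsub>M\<^esub> T"] T \<sigma>T by auto
  obtain c where c: "c \<in> carrier R" "x = c \<odot>\<^bsub>M\<^esub> T" using mult_T x by blast
  have "T = (u \<odot>\<^bsub>M\<^esub> T) \<otimes>\<^bsub>M\<^esub> T" using T u by (metis S.l_one)
  also have "\<dots> = u \<odot>\<^bsub>M\<^esub> (e \<odot>\<^bsub>M\<^esub> T)" using T u e by (simp add: A.smult_assoc2)
  also have "\<dots> = e \<odot>\<^bsub>M\<^esub> (u \<odot>\<^bsub>M\<^esub> T)" using T u e by (metis A.R.m_comm A.smult_assoc1)
  finally have "T = e \<odot>\<^bsub>M\<^esub> \<one>\<^bsub>M\<^esub>" using u by simp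
  then have "x = (c \<otimes>\<^bsub>R\<^esub> e) \<odot>\<^bsub>M\<^esub> \<one>\<^bsub>M\<^esub>" using c e by (simp add: A.smult_assoc1)
  then show ?thesis using c e by blast
qed

section \<open>Powers of a prime\<close>

lemma (in cring) finite_exists_maximalideal:
  assumes "finite (carrier R)" "ideal J R" "J \<noteq> carrier R"
  shows "\<exists>I. maximalideal I R \<and> J \<subseteq> I"
proof -
  let ?X = "{I. ideal I R \<and> I \<noteq> carrier R}"
  have sub: "I \<subseteq> carrier R" if "ideal I R" for I using ideal.Icarr[OF that] by blast
  have "finite ?X" by (rule finite_subset[of _ "Pow (carrier R)"]) (use sub assms(1) in auto)
  then obtain I where I: "I \<in> ?X" "J \<subseteq> I" "\<And>I'. I' \<in> ?X \<Longrightarrow> I \<subseteq> I' \<Longrightarrow> I = I'"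
    using finite_has_maximal2[OF \<open>finite ?X\<close>, of J] assms(2,3) by auto
  have "maximalideal I R"
  proof (rule maximalidealI)
    fix I' assume "ideal I' R" "I \<subseteq> I'" "I' \<subseteq> carrier R"
    then show "I' = I \<or> I' = carrier R" using I(3)[of I'] by (cases "I' = carrier R") simp_all
  qed (use I(1) in auto)
  then show ?thesis using I by blast
qed

lemma scalar_eq_add_pow_one:
  assumes "algebra (residue_ring (int n)) S" "n \<ge> 2" "c \<in> carrier (residue_ring (int n))"
  shows "\<exists>m::nat. c \<odot>\<^bsub>S\<^esub> \<one>\<^bsub>S\<^esub> = [m] \<cdot>\<^bsub>S\<^esub> \<one>\<^bsub>S\<^esub>"
proof -
  interpret S: cring S using assms(1) by (rule algebra.M_cring)
  interpret A: algebra "residue_ring (int n)" S by fact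
  let ?R = "residue_ring (int n)"
  have "int k \<odot>\<^bsub>S\<^esub> \<one>\<^bsub>S\<^esub> = [k] \<cdot>\<^bsub>S\<^esub> \<one>\<^bsub>S\<^esub>" if "k < n" for k
    using that
  proof (induction k)
    case 0
    have "\<zero>\<^bsub>?R\<^esub> \<odot>\<^bsub>S\<^esub> \<one>\<^bsub>S\<^esub> = \<zero>\<^bsub>S\<^esub>" by simp
    then show ?case by (simp add: residue_ring_def)
  next
    case (Suc k)
    have "int (Suc k) = int k \<oplus>\<^bsub>?R\<^esub> \<one>\<^bsub>?R\<^esub>" "int k \<in> carrier ?R"
      using Suc.prems by (simp_all add: residue_ring_def)
    then show ?case using Suc A.smult_l_distr[of "int k" "\<one>\<^bsub>?R\<^esub>" "\<one>\<^bsub>S\<^esub>"]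
      by (simp add: S.add.nat_pow_Suc)
  qed
  from this[of "nat c"] show ?thesis
    using assms(2,3) by (auto simp: residue_ring_def)
qed

lemma AlgAut_pow_apply:
  assumes "algebra R S" "f \<in> carrier (AlgAut R S)" "x \<in> carrier S"
  shows "(f [^]\<^bsub>AlgAut R S\<^esub> (k::nat)) x = (f ^^ k) x"
proof -
  interpret G: group "AlgAut R S" using assms(1) by (rule group_AlgAut)
  have Bij: "g \<in> Bij (carrier S)" if "g \<in> carrier (AlgAut R S)" for g
    using that by (simp add: AlgAut_def alg_auto_def)
  show ?thesis using assms(3)
  proof (induction k arbitrary: x)
    case 0
    then show ?case by (simp add: AlgAut_def BijGroup_def)
  next
    case (Suc k)
    have fx: "f x \<in> carrier S" using Bij_imp_funcset[OF Bij[OF assms(2)]] Suc.prems by blast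
    have "(f [^]\<^bsub>AlgAut R S\<^esub> Suc k) x = (f [^]\<^bsub>AlgAut R S\<^esub> k) (f x)"
      using Bij[OF assms(2)] Bij[OF G.nat_pow_closed[OF assms(2)]] Suc.prems
      by (simp add: AlgAut_def BijGroup_def compose_eq)
    then show ?case using Suc.IH[OF fx] by (simp add: funpow_swap1)
  qed
qed

theorem theorem3:
  fixes n d p :: nat
    and S :: "(int, 'a, 'm) module_scheme"
    and \<sigma> :: "'a \<Rightarrow> 'a"
    and \<theta> :: 'a
  assumes "n \<ge> 2"
    and "algebra (residue_ring (int n)) S"
    and "inj_on (\<lambda>r. r \<odot>\<^bsub>S\<^esub> \<one>\<^bsub>S\<^esub>) (carrier (residue_ring (int n)))"
    and "d \<ge> 1"
    and "free_of_rank (residue_ring (int n)) S d"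
    and "\<sigma> \<in> carrier (AlgAut (residue_ring (int n)) S)"
    and "card (generate (AlgAut (residue_ring (int n)) S) {\<sigma>}) = d"
    and "\<exists>\<omega>\<in>carrier S. is_basis (residue_ring (int n)) S d (\<lambda>i. (\<sigma> ^^ i) \<omega>)"
    and "\<theta> \<in> Units S"
    and "\<theta> [^]\<^bsub>S\<^esub> n = \<sigma> \<theta>"
    and "prime p"
    and "p dvd n"
    and "reduced_ring (S Quot (multiples_ideal S p))"
    and "card (generate (units_of (S Quot (multiples_ideal S p)))
               {multiples_ideal S p +>\<^bsub>S\<^esub> \<theta>}) \<ge> n ^ nat \<lfloor>sqrt (real d)\<rfloor>"
  shows "\<exists>k. n = p ^ k"
proof -
  let ?R = "residue_ring (int n)"
  let ?J = "multiples_ideal S p"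
  let ?s = "nat \<lfloor>sqrt (real d)\<rfloor>"
  have d: "d > 0" using \<open>d \<ge> 1\<close> by simp
  note alg = \<open>algebra ?R S\<close>
  interpret S: cring S using alg by (rule algebra.M_cring)
  interpret Aut: group "AlgAut ?R S" using alg by (rule group_AlgAut)
  have \<sigma>: "\<sigma> \<in> ring_hom S S"
      "\<And>r x. r \<in> carrier ?R \<Longrightarrow> x \<in> carrier S \<Longrightarrow> \<sigma> (r \<odot>\<^bsub>S\<^esub> x) = r \<odot>\<^bsub>S\<^esub> \<sigma> x"
    using \<open>\<sigma> \<in> carrier (AlgAut ?R S)\<close> by (auto simp: AlgAut_def alg_auto_def)
  have \<sigma>_period: "(\<sigma> ^^ d) x = x" if "x \<in> carrier S" for x
  proof -
    have "\<sigma> [^]\<^bsub>AlgAut ?R S\<^esub> d = \<one>\<^bsub>AlgAut ?R S\<^esub>"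
      using Aut.pow_ord_eq_1[OF assms(6)] Aut.generate_pow_card[OF assms(6)] assms(7) by simp
    then show ?thesis
      using AlgAut_pow_apply[OF alg assms(6) that, of d] that by (simp add: AlgAut_def BijGroup_def)
  qed
  obtain \<omega> where basis: "is_basis ?R S d (\<lambda>i. (\<sigma> ^^ i) \<omega>)" using assms(8) by blast
  interpret cyclic_over_prime_ring S \<sigma> d
  proof unfold_locales
    fix x assume "x \<in> carrier S" "\<sigma> x = x"
    then obtain c where "c \<in> carrier ?R" "x = c \<odot>\<^bsub>S\<^esub> \<one>\<^bsub>S\<^esub>"
      using fixed_point_of_normal_basis_is_scalar[OF alg d \<sigma> \<sigma>_period basis] by blast
    then show "\<exists>m::nat. x = [m] \<cdot>\<^bsub>S\<^esub> \<one>\<^bsub>S\<^esub>"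
      using scalar_eq_add_pow_one[OF alg \<open>n \<ge> 2\<close>] by blast
  qed (use \<sigma> d \<sigma>_period in simp_all)
  have pJ: "[p] \<cdot>\<^bsub>S\<^esub> \<one>\<^bsub>S\<^esub> \<in> ?J" and J: "ideal ?J S"
    unfolding multiples_ideal_def by (intro S.cgenideal_self S.cgenideal_ideal; simp)+
  have quot_hom: "ring_hom_cring S (S Quot I) ((+>\<^bsub>S\<^esub>) I)" if "ideal I S" for I
    using that S.is_cring by (rule ideal.rcos_ring_hom_cring)
  have quot_char: "[p] \<cdot>\<^bsub>S Quot I\<^esub> \<one>\<^bsub>S Quot I\<^esub> = \<zero>\<^bsub>S Quot I\<^esub>" if "ideal I S" "?J \<subseteq> I" for I
  proof -
    have "I +>\<^bsub>S\<^esub> ([p] \<cdot>\<^bsub>S\<^esub> \<one>\<^bsub>S\<^esub>) = I" using that pJ by (intro S.a_rcos_zero) auto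
    then show ?thesis
      using ring_hom_cring.hom_add_pow_one[OF quot_hom[OF that(1)], of p] by (simp add: FactRing_def)
  qed
  let ?L = "S Quot ?J"
  let ?t = "?J +>\<^bsub>S\<^esub> \<theta>"
  let ?U = "units_of ?L"
  interpret g: ring_hom_cring S ?L "(+>\<^bsub>S\<^esub>) ?J" by (rule quot_hom[OF J])
  interpret U: group ?U by (rule g.S.units_group)
  have t: "?t \<in> carrier ?U"
  proof -
    have \<theta>: "\<theta> \<in> carrier S" "inv\<^bsub>S\<^esub> \<theta> \<in> carrier S" using assms(9) by auto
    have "?t \<otimes>\<^bsub>?L\<^esub> (?J +>\<^bsub>S\<^esub> inv\<^bsub>S\<^esub> \<theta>) = \<one>\<^bsub>?L\<^esub>"
      using \<theta> assms(9) by (simp flip: g.hom_mult)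
    moreover from this have "(?J +>\<^bsub>S\<^esub> inv\<^bsub>S\<^esub> \<theta>) \<otimes>\<^bsub>?L\<^esub> ?t = \<one>\<^bsub>?L\<^esub>"
      using \<theta> by (subst g.S.m_comm) simp_all
    moreover have "?t \<in> carrier ?L" "?J +>\<^bsub>S\<^esub> inv\<^bsub>S\<^esub> \<theta> \<in> carrier ?L" using \<theta> by simp_all
    ultimately show ?thesis unfolding units_of_carrier Units_def by blast
  qed
  define r where "r = U.ord ?t"
  have r: "?t [^]\<^bsub>?L\<^esub> k = \<one>\<^bsub>?L\<^esub> \<longleftrightarrow> r dvd k" for k :: nat
    using U.pow_eq_id[OF t, of k] t
    by (simp add: r_def g.S.units_of_pow units_of_one units_of_carrier)
  have r_ge: "n ^ ?s \<le> r" using assms(14) U.generate_pow_card[OF t] by (simp add: r_def)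
  have "1 \<le> sqrt (real d)" using d by simp
  then have s: "?s \<ge> 1" by (simp add: le_nat_iff le_floor_iff)
  have d_less: "d < (?s + 1)\<^sup>2"
  proof -
    have "sqrt (real d) < real (?s + 1)" using s by linarith
    then have "real d < (real (?s + 1))\<^sup>2"
      using real_sqrt_less_iff[of "real d" "(real (?s + 1))\<^sup>2"] by simp
    then have "real d < real ((?s + 1)\<^sup>2)" by (simp only: of_nat_power)
    then show ?thesis by (simp only: of_nat_less_iff)
  qed
  \<comment> \<open>If \<open>p\<close> were a unit of \<open>S\<close>, the quotient would be trivial and \<open>\<theta>\<close> would have order \<open>1\<close>.\<close>
  have "?J \<noteq> carrier S"
  proof
    assume "?J = carrier S"
    then have "?t = ?J" "\<one>\<^bsub>?L\<^esub> = ?J"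
      using S.a_rcos_zero[OF J] assms(9) by (auto simp: FactRing_def)
    then have "?t [^]\<^bsub>?L\<^esub> (1::nat) = \<one>\<^bsub>?L\<^esub>"
      by (metis g.S.nat_pow_one)
    then have "r = 1" unfolding r by simp
    moreover have "n ^ 1 \<le> n ^ ?s"
      using s \<open>n \<ge> 2\<close> by (intro power_increasing) auto
    ultimately show False using r_ge \<open>n \<ge> 2\<close> by simp
  qed
  moreover have "finite (carrier S)"
    using finite_carrier_if_basis[OF _ basis] by (simp add: residue_ring_def)
  ultimately obtain I where I: "maximalideal I S" "?J \<subseteq> I"
    using S.finite_exists_maximalideal J by blast
  then have prime_I: "primeideal I S" by (intro S.maximalideal_prime)
  then have id_I: "ideal I S" by (rule primeideal.axioms)
  note cong = exponents_cong_order[OF quot_hom[OF id_I] primeideal.quotient_is_domain[OF prime_I]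
      quot_hom[OF J] \<open>prime p\<close> quot_char[OF id_I I(2)] quot_char[OF J order.refl] assms(13,9,10) r]
  then obtain z where "[p = n ^ z] (mod r)" by blast
  then show ?thesis
    using power_of_prime_if_exponents_cong[OF assms(11,12,1,4) d_less r_ge cong(1)] by blast
qed

end
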